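(* Let $\mathcal{A}$ be a finite-dimensional evolution algebra over a field $\mathbb{K}$ with a natural basis $B=\{e_i\}_{i\in\Lambda}$ and let $\mathfrak{m}=\operatorname{asi}(\mathcal{A})$. Then $$\operatorname{rad}(\mathcal{A})=\operatorname{span}\{e_i\in B : i\in\lambda_{\mathfrak{m}}(B)\}.$$
   Context: An evolution algebra over a field $\mathbb{K}$ (arbitrary characteristic) is a $\mathbb{K}$-algebra $\mathcal{A}$ (not necessarily associative) admitting a basis $B=\{e_i\}_{i\in\Lambda}$, called a natural basis, with $e_ie_j=0$ for $i\neq j$ and $e_i^2=\sum_{k\in\Lambda} w_{ik}e_k$, where $w_{ik}\in\mathbb{K}$. All algebras are finite-dimensional. For $i\in\Lambda$, $D^1(i)=\{k\in\Lambda : w_{ik}\neq 0\}$. Define $\lambda_0(B)=\emptyset$, $\lambda_1(B)=\{i\in\Lambda : e_i^2=0\}$ and $\lambda_k(B)=\{i\in\Lambda : D^1(i)\subseteq\lambda_{k-1}(B)\}$ for $k>1$. An ideal $I$ of $\mathcal{A}$ has the absorption property if, for $x\in\mathcal{A}$, $x\mathcal{A}\subseteq I$ implies $x\in I$. The absorption radical $\operatorname{rad}(\mathcal{A})$ is the intersection of all ideals of $\mathcal{A}$ having the absorption property. The annihilator is $\operatorname{ann}(\mathcal{A})=\{x\in\mathcal{A}: x\mathcal{A}=\{0\}\}$. The upper annihilating series is defined by $\operatorname{ann}^{(0)}(\mathcal{A})=\{0\}$ and $\operatorname{ann}^{(i)}(\mathcal{A})/\operatorname{ann}^{(i-1)}(\mathcal{A})=\operatorname{ann}(\mathcal{A}/\operatorname{ann}^{(i-1)}(\mathcal{A}))$.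 The annihilator stabilizing index is $\operatorname{asi}(\mathcal{A})=\min\{q\ge 0:\operatorname{ann}^{(q)}(\mathcal{A})=\operatorname{ann}^{(q+1)}(\mathcal{A})\}$. *)

theory Defs
  imports Complex_Main "HOL-Library.Set_Algebras"
begin

text \<open>
  An algebra is a vector space (on a whole type) with a bilinear product; neither associativity,
  nor commutativity, nor a unit is assumed.
\<close>

locale nonassoc_algebra = vector_space scale
  for scale :: "'k::field \<Rightarrow> 'a::ab_group_add \<Rightarrow> 'a" (infixr "*s" 75) +
  fixes mult :: "'a \<Rightarrow> 'a \<Rightarrow> 'a" (infixl "\<odot>" 70)
  assumes linear_mult_right: "Vector_Spaces.linear scale scale (\<lambda>y. x \<odot> y)"
    and linear_mult_left: "Vector_Spaces.linear scale scale (\<lambda>x. x \<odot> y)"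

text \<open>
  Annihilator of an algebra given by its carrier, product and zero, so that it applies both to an
  algebra on a whole type and to its quotients.
\<close>

definition annihilator :: "'b set \<Rightarrow> ('b \<Rightarrow> 'b \<Rightarrow> 'b) \<Rightarrow> 'b \<Rightarrow> 'b set" where
  "annihilator C m z = {x \<in> C. \<forall>y\<in>C. m x y = z}"

context nonassoc_algebra
begin

definition alg_ideal :: "'a set \<Rightarrow> bool" where
  "alg_ideal I \<longleftrightarrow> subspace I \<and> (\<forall>x\<in>I. \<forall>a. x \<odot> a \<in> I \<and> a \<odot> x \<in> I)"

definition absorption_property :: "'a set \<Rightarrow> bool" where
  "absorption_property I \<longleftrightarrow> (\<forall>x. range (\<lambda>a. x \<odot> a) \<subseteq> I \<longrightarrow> x \<in> I)"

definition rad :: "'a set" where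
  "rad = \<Inter> {I. alg_ideal I \<and> absorption_property I}"

text \<open>
  The quotient by an ideal \<open>I\<close> consists of the cosets \<open>x +o I\<close>, its zero being \<open>I\<close> itself.
  The product of two cosets is written without choosing representatives;
  it is the coset of the product, see \<open>quot_mult_coset\<close> below.
\<close>

definition quot_carrier :: "'a set \<Rightarrow> 'a set set" where
  "quot_carrier I = range (\<lambda>x. x +o I)"

definition quot_mult :: "'a set \<Rightarrow> 'a set \<Rightarrow> 'a set \<Rightarrow> 'a set" where
  "quot_mult I X Y = (\<Union>x\<in>X. \<Union>y\<in>Y. (x \<odot> y) +o I)"

definition quot_ann :: "'a set \<Rightarrow> 'a set set" where
  "quot_ann I = annihilator (quot_carrier I) (quot_mult I) I"

text \<open>
  The upper annihilating series: each term is the preimage, under the projection, of the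
  annihilator of the quotient by the preceding term.
\<close>

primrec upper_ann :: "nat \<Rightarrow> 'a set" where
  "upper_ann 0 = {0}"
| "upper_ann (Suc i) = {x. x +o upper_ann i \<in> quot_ann (upper_ann i)}"

definition asi :: nat where
  "asi = (LEAST q. upper_ann q = upper_ann (Suc q))"

lemma quot_mult_coset:
  assumes "alg_ideal I"
  shows "quot_mult I (x +o I) (y +o I) = (x \<odot> y) +o I"
proof -
  interpret r: Vector_Spaces.linear scale scale "\<lambda>y. a \<odot> y" for a by (rule linear_mult_right)
  interpret l: Vector_Spaces.linear scale scale "\<lambda>x. x \<odot> b" for b by (rule linear_mult_left)
  have sub: "subspace I" and ab: "\<And>u a. u \<in> I \<Longrightarrow> u \<odot> a \<in> I \<and> a \<odot> u \<in> I"
    using assms by (auto simp: alg_ideal_def)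
  have "((x + u) \<odot> (y + v)) +o I = (x \<odot> y) +o I" if "u \<in> I" "v \<in> I" for u v
  proof -
    define w where "w = x \<odot> v + u \<odot> y + u \<odot> v"
    have w: "w \<in> I"
      unfolding w_def using that ab sub by (intro subspace_add) auto
    have eq: "(x + u) \<odot> (y + v) = x \<odot> y + w"
      by (simp add: w_def r.add l.add algebra_simps)
    have "w + v \<in> I" "\<exists>u\<in>I. v = w + u" if "v \<in> I" for v
      using that w sub by (auto intro: subspace_add subspace_diff bexI[of _ "v - w"])
    then show ?thesis
      unfolding eq elt_set_plus_def by (auto simp: add.assoc)
  qed
  moreover have "I \<noteq> {}" using sub by (auto dest: subspace_0)
  moreover have "quot_mult I (x +o I) (y +o I) = (\<Union>u\<in>I. \<Union>v\<in>I. ((x + u) \<odot> (y + v)) +o I)"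
    by (auto simp: quot_mult_def elt_set_plus_def)
  ultimately show ?thesis by simp
qed

lemma upper_ann_quotient:
  "(\<lambda>x. x +o upper_ann i) ` upper_ann (Suc i) = quot_ann (upper_ann i)"
  by (auto simp: quot_ann_def annihilator_def quot_carrier_def)

end

text \<open>
  \<open>e\<close> is the natural basis, indexed by the finite set \<open>\<Lambda>\<close>, and \<open>w\<close> holds the structure constants;
  only the values of \<open>e\<close> and \<open>w\<close> on indices in \<open>\<Lambda>\<close> matter.
\<close>

locale evolution_algebra = nonassoc_algebra scale mult
  for scale :: "'k::field \<Rightarrow> 'a::ab_group_add \<Rightarrow> 'a" (infixr "*s" 75)
    and mult :: "'a \<Rightarrow> 'a \<Rightarrow> 'a" (infixl "\<odot>" 70) +
  fixes \<Lambda> :: "'i set"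
    and e :: "'i \<Rightarrow> 'a"
    and w :: "'i \<Rightarrow> 'i \<Rightarrow> 'k"
  assumes finite_index: "finite \<Lambda>"
    and inj_basis: "inj_on e \<Lambda>"
    and independent_basis: "independent (e ` \<Lambda>)"
    and span_basis: "span (e ` \<Lambda>) = UNIV"
    and mult_distinct: "\<lbrakk>i \<in> \<Lambda>; j \<in> \<Lambda>; i \<noteq> j\<rbrakk> \<Longrightarrow> e i \<odot> e j = 0"
    and mult_square: "i \<in> \<Lambda> \<Longrightarrow> e i \<odot> e i = (\<Sum>k\<in>\<Lambda>. w i k *s e k)"
begin

definition D1 :: "'i \<Rightarrow> 'i set" where
  "D1 i = {k \<in> \<Lambda>. w i k \<noteq> 0}"

fun lam :: "nat \<Rightarrow> 'i set" where
  "lam 0 = {}"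
| "lam (Suc 0) = {i \<in> \<Lambda>. e i \<odot> e i = 0}"
| "lam (Suc (Suc k)) = {i \<in> \<Lambda>. D1 i \<subseteq> lam (Suc k)}"

end

end

theory Submission imports Defs begin

text \<open>
  Write \<open>abs_hull S = {x. \<forall>y. x \<odot> y \<in> S}\<close> for the set of elements absorbed by \<open>S\<close>. An ideal
  has the absorption property precisely if it contains its own absorption hull. An evolution algebra
  is commutative, so the terms of its upper annihilating series are ideals, and the series iterates
  \<open>abs_hull\<close> from \<open>{0}\<close>. By induction, every ideal with
  the absorption property therefore contains every term of the series. Conversely, the term where
  the series first stabilizes is an ideal equal to its absorption hull, so it has the absorption
  property. Hence it is the radical (\<open>rad_eq_upper_ann_asi\<close>).

  In coordinates, \<open>x \<odot> e i = x\<^sub>i *s (e i \<odot> e i)\<close>, where \<open>x\<^sub>i\<close> is the coefficient of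
  \<open>x\<close> at \<open>e i\<close>. So \<open>x\<close> lies in the absorption hull of the span of \<open>e ` S\<close> if and only if
  \<open>D1 i \<subseteq> S\<close> whenever \<open>x\<^sub>i \<noteq> 0\<close> (\<open>abs_hull_span\<close>). This is the recursion that defines
  \<open>lam\<close>, so the term of index \<open>n\<close> of the series is the span of \<open>e ` lam n\<close>
  (\<open>upper_ann_eq_span\<close>). The sets \<open>lam n\<close> increase inside the finite set \<open>\<Lambda>\<close>, so the
  series does stabilize.
\<close>

section \<open>Absorption hulls and the upper annihilating series\<close>

context nonassoc_algebra
begin

lemma mult_add_left: "(x + y) \<odot> z = x \<odot> z + y \<odot> z"
  by (rule module_hom.add[OF Vector_Spaces.linear.axioms(3)[OF linear_mult_left]])

lemma mult_scale_left: "(c *s x) \<odot> z = c *s (x \<odot> z)"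
  by (rule module_hom.scale[OF Vector_Spaces.linear.axioms(3)[OF linear_mult_left]])

lemma mult_zero_left: "0 \<odot> z = 0"
  by (rule module_hom.zero[OF Vector_Spaces.linear.axioms(3)[OF linear_mult_left]])

lemma mult_sum_left: "sum f S \<odot> z = (\<Sum>i\<in>S. f i \<odot> z)"
  by (rule module_hom.sum[OF Vector_Spaces.linear.axioms(3)[OF linear_mult_left]])

lemma mult_scale_right: "z \<odot> (c *s x) = c *s (z \<odot> x)"
  by (rule module_hom.scale[OF Vector_Spaces.linear.axioms(3)[OF linear_mult_right]])

lemma mult_sum_right: "z \<odot> sum f S = (\<Sum>i\<in>S. z \<odot> f i)"
  by (rule module_hom.sum[OF Vector_Spaces.linear.axioms(3)[OF linear_mult_right]])

text \<open>The absorption hull of \<open>S\<close>: the elements whose right multiples all lie in \<open>S\<close>.\<close>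

definition abs_hull :: "'a set \<Rightarrow> 'a set" where
  "abs_hull S = {x. \<forall>y. x \<odot> y \<in> S}"

lemma abs_hull_mono: "S \<subseteq> T \<Longrightarrow> abs_hull S \<subseteq> abs_hull T"
  by (auto simp: abs_hull_def)

lemma absorption_property_iff: "absorption_property I \<longleftrightarrow> abs_hull I \<subseteq> I"
  by (auto simp: absorption_property_def abs_hull_def)

lemma coset_eq_iff:
  assumes "subspace I"
  shows "x +o I = I \<longleftrightarrow> x \<in> I"
proof
  assume "x +o I = I"
  moreover have "x + 0 \<in> x +o I"
    using subspace_0[OF assms] by (rule set_plus_intro2)
  ultimately show "x \<in> I" by simp
next
  assume x: "x \<in> I"
  have "y \<in> x +o I" if "y \<in> I" for y
    using set_plus_intro2[OF subspace_diff[OF assms that x], of x] by simp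
  with x show "x +o I = I"
    by (auto simp: elt_set_plus_def intro: subspace_add[OF assms])
qed

lemma coset_in_quot_ann_iff:
  assumes "alg_ideal I"
  shows "x +o I \<in> quot_ann I \<longleftrightarrow> x \<in> abs_hull I"
proof -
  have "subspace I" using assms by (simp add: alg_ideal_def)
  then show ?thesis
    by (auto simp: quot_ann_def annihilator_def quot_carrier_def quot_mult_coset[OF assms]
        coset_eq_iff abs_hull_def)
qed

lemma upper_ann_Suc_eq_abs_hull:
  "alg_ideal (upper_ann n) \<Longrightarrow> upper_ann (Suc n) = abs_hull (upper_ann n)"
  by (simp add: coset_in_quot_ann_iff)

text \<open>
  Commutativity makes the one-sided condition that defines the annihilator two-sided.
\<close>

lemma alg_ideal_abs_hull:
  assumes comm: "\<And>x y. x \<odot> y = y \<odot> x" and I: "alg_ideal I"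
  shows "alg_ideal (abs_hull I)"
proof -
  have I: "subspace I" "\<And>x y. x \<in> I \<Longrightarrow> x \<odot> y \<in> I"
    using I by (auto simp: alg_ideal_def)
  have "subspace (abs_hull I)"
    by (rule subspaceI)
      (auto simp: abs_hull_def mult_zero_left mult_add_left mult_scale_left
        intro: I(1) subspace_0 subspace_add subspace_scale)
  moreover have "x \<odot> y \<in> abs_hull I" if "x \<in> abs_hull I" for x y
    using that I(2) by (auto simp: abs_hull_def)
  ultimately show ?thesis
    using comm by (auto simp: alg_ideal_def)
qed

lemma alg_ideal_upper_ann:
  assumes comm: "\<And>x y. x \<odot> y = y \<odot> x"
  shows "alg_ideal (upper_ann n)"
proof (induction n)
  case 0
  have "x \<odot> 0 = 0" for x
    using comm[of x 0] by (simp add: mult_zero_left)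
  then show ?case
    by (auto simp: alg_ideal_def mult_zero_left)
next
  case (Suc n)
  then show ?case
    unfolding upper_ann_Suc_eq_abs_hull[OF Suc] by (rule alg_ideal_abs_hull[OF comm])
qed

text \<open>
  Without the second assumption, \<open>asi\<close> would be the least element of an empty set of indices.
\<close>

lemma rad_eq_upper_ann_asi:
  assumes comm: "\<And>x y. x \<odot> y = y \<odot> x"
    and stab: "\<exists>q. upper_ann q = upper_ann (Suc q)"
  shows "rad = upper_ann asi"
proof -
  note ideal = alg_ideal_upper_ann[OF comm]
  note Suc_eq = upper_ann_Suc_eq_abs_hull[OF ideal]
  have "upper_ann asi = upper_ann (Suc asi)"
    unfolding asi_def using stab by (rule LeastI_ex)
  then have "absorption_property (upper_ann asi)"
    by (simp only: absorption_property_iff Suc_eq order_refl)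
  then have "rad \<subseteq> upper_ann asi"
    using ideal by (auto simp: rad_def)
  moreover have "upper_ann n \<subseteq> I" if "alg_ideal I" "absorption_property I" for I n
  proof (induction n)
    case 0
    then show ?case using that(1) by (auto simp: alg_ideal_def intro: subspace_0)
  next
    case (Suc n)
    then show ?case
      unfolding Suc_eq using abs_hull_mono that(2) absorption_property_iff by blast
  qed
  then have "upper_ann asi \<subseteq> rad"
    by (auto simp: rad_def)
  ultimately show ?thesis ..
qed

end

section \<open>Natural bases: coordinates and the sets \<open>lam n\<close>\<close>

context evolution_algebra
begin

text \<open>The coefficient of \<open>x\<close> at the basis vector \<open>e i\<close>; it is meaningful for \<open>i \<in> \<Lambda>\<close> only.\<close>

definition coord :: "'i \<Rightarrow> 'a \<Rightarrow> 'k" where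
  "coord i x = representation (e ` \<Lambda>) x (e i)"

lemma sum_coord: "(\<Sum>i\<in>\<Lambda>. coord i x *s e i) = x"
proof -
  have "(\<Sum>b\<in>e ` \<Lambda>. representation (e ` \<Lambda>) x b *s b) = x"
    by (rule sum_representation_eq[OF independent_basis]) (simp_all add: span_basis finite_index)
  then show ?thesis
    by (simp add: sum.reindex inj_basis coord_def)
qed

lemma coord_sum_basis:
  assumes "k \<in> \<Lambda>"
  shows "coord k (\<Sum>i\<in>\<Lambda>. c i *s e i) = c k"
proof -
  have "coord k (\<Sum>i\<in>\<Lambda>. c i *s e i) = (\<Sum>i\<in>\<Lambda>. c i * coord k (e i))"
    unfolding coord_def
    using independent_basis by (simp add: representation_sum representation_scale span_basis)
  also have "\<dots> = (\<Sum>i\<in>\<Lambda>. if i = k then c i else 0)"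
  proof (rule sum.cong[OF refl])
    fix i assume "i \<in> \<Lambda>"
    then show "c i * coord k (e i) = (if i = k then c i else 0)"
      using assms inj_basis independent_basis
      by (auto simp: coord_def representation_basis inj_on_eq_iff)
  qed
  finally show ?thesis
    using assms finite_index by simp
qed

lemma in_span_basis_iff:
  assumes "S \<subseteq> \<Lambda>"
  shows "x \<in> span (e ` S) \<longleftrightarrow> (\<forall>i\<in>\<Lambda>. coord i x \<noteq> 0 \<longrightarrow> i \<in> S)"
proof
  assume x: "x \<in> span (e ` S)"
  show "\<forall>i\<in>\<Lambda>. coord i x \<noteq> 0 \<longrightarrow> i \<in> S"
  proof (intro ballI impI)
    fix i assume i: "i \<in> \<Lambda>" "coord i x \<noteq> 0"
    have "representation (e ` \<Lambda>) x = representation (e ` S) x"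
      using independent_basis x image_mono[OF assms] by (rule representation_extend)
    then have "e i \<in> e ` S"
      using i representation_ne_zero[of "e ` S" x "e i"] by (simp add: coord_def)
    then show "i \<in> S"
      using inj_on_image_mem_iff[OF inj_basis i(1) assms] by blast
  qed
next
  assume *: "\<forall>i\<in>\<Lambda>. coord i x \<noteq> 0 \<longrightarrow> i \<in> S"
  have "coord i x *s e i \<in> span (e ` S)" if "i \<in> \<Lambda>" for i
    using * that by (cases "coord i x = 0") (auto intro: span_zero span_scale span_base)
  then have "(\<Sum>i\<in>\<Lambda>. coord i x *s e i) \<in> span (e ` S)"
    by (rule span_sum)
  then show "x \<in> span (e ` S)"
    by (simp add: sum_coord)
qed

lemma mult_basis_right:
  assumes "i \<in> \<Lambda>"
  shows "x \<odot> e i = coord i x *s (e i \<odot> e i)"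
proof -
  have "x \<odot> e i = (\<Sum>j\<in>\<Lambda>. coord j x *s (e j \<odot> e i))"
    by (subst sum_coord[of x, symmetric]) (simp add: mult_sum_left mult_scale_left)
  also have "\<dots> = (\<Sum>j\<in>\<Lambda>. if j = i then coord j x *s (e i \<odot> e i) else 0)"
    using assms by (intro sum.cong refl) (auto simp: mult_distinct)
  finally show ?thesis
    using assms finite_index by simp
qed

lemma mult_basis_left:
  assumes "i \<in> \<Lambda>"
  shows "e i \<odot> x = coord i x *s (e i \<odot> e i)"
proof -
  have "e i \<odot> x = (\<Sum>j\<in>\<Lambda>. coord j x *s (e i \<odot> e j))"
    by (subst sum_coord[of x, symmetric]) (simp add: mult_sum_right mult_scale_right)
  also have "\<dots> = (\<Sum>j\<in>\<Lambda>. if j = i then coord j x *s (e i \<odot> e i) else 0)"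
    using assms by (intro sum.cong refl) (auto simp: mult_distinct)
  finally show ?thesis
    using assms finite_index by simp
qed

lemma mult_eq_sum_basis: "x \<odot> y = (\<Sum>i\<in>\<Lambda>. coord i y *s (x \<odot> e i))"
  by (subst sum_coord[of y, symmetric]) (simp add: mult_sum_right mult_scale_right)

lemma mult_commute: "x \<odot> y = y \<odot> x"
proof -
  have "y \<odot> x = (\<Sum>i\<in>\<Lambda>. coord i y *s (e i \<odot> x))"
    by (subst sum_coord[of y, symmetric]) (simp add: mult_sum_left mult_scale_left)
  then show ?thesis
    unfolding mult_eq_sum_basis[of x y]
    by (simp add: mult_basis_left[of _ x] mult_basis_right[of _ x])
qed

lemma coord_mult_basis:
  assumes "i \<in> \<Lambda>" "k \<in> \<Lambda>"
  shows "coord k (x \<odot> e i) = coord i x * w i k"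
proof -
  have "x \<odot> e i = (\<Sum>k\<in>\<Lambda>. (coord i x * w i k) *s e k)"
    unfolding mult_basis_right[OF assms(1), of x]
    by (simp add: mult_square assms(1) scale_sum_right)
  then show ?thesis
    using assms(2) by (simp add: coord_sum_basis)
qed

lemma abs_hull_span:
  assumes "S \<subseteq> \<Lambda>"
  shows "abs_hull (span (e ` S)) = span (e ` {i \<in> \<Lambda>. D1 i \<subseteq> S})"
proof (rule set_eqI)
  fix x
  have "x \<in> abs_hull (span (e ` S)) \<longleftrightarrow> (\<forall>i\<in>\<Lambda>. x \<odot> e i \<in> span (e ` S))"
  proof
    assume "\<forall>i\<in>\<Lambda>. x \<odot> e i \<in> span (e ` S)"
    then have "x \<odot> y \<in> span (e ` S)" for y
      unfolding mult_eq_sum_basis[of x y] by (auto intro: span_sum span_scale)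
    then show "x \<in> abs_hull (span (e ` S))"
      by (simp add: abs_hull_def)
  qed (simp add: abs_hull_def)
  also have "\<dots> \<longleftrightarrow> (\<forall>i\<in>\<Lambda>. \<forall>k\<in>\<Lambda>. coord i x * w i k \<noteq> 0 \<longrightarrow> k \<in> S)"
    using in_span_basis_iff[OF assms] coord_mult_basis by simp
  also have "\<dots> \<longleftrightarrow> (\<forall>i\<in>\<Lambda>. coord i x \<noteq> 0 \<longrightarrow> i \<in> {i \<in> \<Lambda>. D1 i \<subseteq> S})"
    by (auto simp: D1_def)
  also have "\<dots> \<longleftrightarrow> x \<in> span (e ` {i \<in> \<Lambda>. D1 i \<subseteq> S})"
    by (rule in_span_basis_iff[symmetric]) auto
  finally show "x \<in> abs_hull (span (e ` S)) \<longleftrightarrow> x \<in> span (e ` {i \<in> \<Lambda>. D1 i \<subseteq> S})" .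
qed

lemma square_eq_0_iff:
  assumes "i \<in> \<Lambda>"
  shows "e i \<odot> e i = 0 \<longleftrightarrow> D1 i = {}"
proof -
  have "e i \<odot> e i \<in> span (e ` {}) \<longleftrightarrow> D1 i = {}"
    using in_span_basis_iff[of "{}" "e i \<odot> e i"] assms
    by (auto simp: mult_square coord_sum_basis D1_def)
  then show ?thesis by simp
qed

text \<open>The recursion for \<open>lam\<close> also holds at its first step, which is defined separately.\<close>

lemma lam_Suc: "lam (Suc n) = {i \<in> \<Lambda>. D1 i \<subseteq> lam n}"
  by (cases n) (auto simp: square_eq_0_iff)

lemma lam_subset_index: "lam n \<subseteq> \<Lambda>"
  by (induction n) (auto simp: lam_Suc simp del: lam.simps(2,3))

lemma lam_subset_Suc: "lam n \<subseteq> lam (Suc n)"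
proof (induction n)
  case (Suc n)
  then show ?case
    unfolding lam_Suc[of n] lam_Suc[of "Suc n"] by blast
qed simp

lemma lam_stabilizes: "\<exists>q. lam q = lam (Suc q)"
proof -
  have card_le: "card (lam n) \<le> card \<Lambda>" for n
    using finite_index lam_subset_index by (rule card_mono)
  then obtain q where max: "\<And>n. card (lam n) \<le> card (lam q)"
    using ex_has_greatest_nat[of "\<lambda>_. True" 0 "\<lambda>n. card (lam n)" "Suc (card \<Lambda>)"]
    by (auto simp: less_Suc_eq_le)
  have "lam q = lam (Suc q)"
    using finite_subset[OF lam_subset_index finite_index] lam_subset_Suc max
    by (intro card_seteq)
  then show ?thesis ..
qed

lemma upper_ann_eq_span: "upper_ann n = span (e ` lam n)"
proof (induction n)
  case 0
  then show ?case by simp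
next
  case (Suc n)
  have "upper_ann (Suc n) = abs_hull (upper_ann n)"
    by (rule upper_ann_Suc_eq_abs_hull[OF alg_ideal_upper_ann[OF mult_commute]])
  also have "\<dots> = span (e ` lam (Suc n))"
    unfolding Suc lam_Suc by (rule abs_hull_span[OF lam_subset_index])
  finally show ?case .
qed

theorem rad_eq_span_lam_asi: "rad = span (e ` lam asi)"
proof -
  have "\<exists>q. upper_ann q = upper_ann (Suc q)"
    unfolding upper_ann_eq_span using lam_stabilizes by metis
  then have "rad = upper_ann asi"
    by (rule rad_eq_upper_ann_asi[OF mult_commute])
  then show ?thesis
    by (simp only: upper_ann_eq_span)
qed

end

theorem corollary3p5:
  fixes scale :: "'k::field \<Rightarrow> 'a::ab_group_add \<Rightarrow> 'a"
    and mult :: "'a \<Rightarrow> 'a \<Rightarrow> 'a"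
    and \<Lambda> :: "'i set"
    and e :: "'i \<Rightarrow> 'a"
    and w :: "'i \<Rightarrow> 'i \<Rightarrow> 'k"
    and m :: nat
  assumes "evolution_algebra scale mult \<Lambda> e w"
    and "m = nonassoc_algebra.asi mult"
  shows "nonassoc_algebra.rad scale mult =
    module.span scale (e ` evolution_algebra.lam mult \<Lambda> e w m)"
  unfolding assms(2) by (rule evolution_algebra.rad_eq_span_lam_asi[OF assms(1)])

end
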